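(* Let $P,Q$ be two curves in $\mathbb{R}^d$ with $m_1$ and $m_2$ vertices, respectively, let $m=\min\{m_1,m_2\}$, let $r>0$, and let $\delta=4dmr$ and $c=4d^{3/2}m$. Let $t$ be uniformly distributed in $[0,\delta)^d$. Then: (i) if $d_F(P,Q)<r$, then $\Pr_t\left(h^t_\delta(P)=h^t_\delta(Q)\right)>\frac12$; (ii) if $d_F(P,Q)>cr$, then $\Pr_t\left(h^t_\delta(P)=h^t_\delta(Q)\right)=0$.
   Context: A curve in $\mathbb{R}^d$ is given by its finite sequence of vertices $P=p_1,\dots,p_m\in\mathbb{R}^d$, $m\geq 1$; two curves are equal if their vertex sequences are equal. Given curves $P=p_1,\dots,p_{m_1}$ and $Q=q_1,\dots,q_{m_2}$, a traversal is a sequence of index pairs $T=(i_1,j_1),\dots,(i_\ell,j_\ell)$ with $(i_1,j_1)=(1,1)$, $(i_\ell,j_\ell)=(m_1,m_2)$, and, for every $k<\ell$, $i_{k+1}-i_k\in\{0,1\}$, $j_{k+1}-j_k\in\{0,1\}$ and $(i_{k+1}-i_k)+(j_{k+1}-j_k)\ge 1$. The discrete Fréchet distance is $d_F(P,Q)=\min_{T}\max_{(i,j)\in T}\|p_i-q_j\|$, over all traversals $T$, with $\|\cdot\|$ the Euclidean norm. Basic hash function: for $\delta>0$ let $G_\delta=\{(x_1,\dots,x_d): x_i\in\delta\mathbb{Z}\ \forall i\}$ and, for $t\in[0,\delta)^d$, $\widehat G^t_\delta=\{p+t: p\in G_\delta\}$. For a curve $P=p_1,\dots,p_m$, the curve $h^t_\delta(P)$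 is obtained by (1) replacing each vertex $p_i$ by its closest point $p_i'$ of $\widehat G^t_\delta$ (ties broken by a fixed rule, say the lexicographically smallest closest point), and (2) removing consecutive duplicates, i.e., removing $p_i'$ whenever it is identical to $p_{i-1}'$. *)

theory Defs
  imports "HOL-Probability.Probability" "HOL-Library.Fun_Lexorder"
begin

text \<open>A curve is the nonempty list of its vertices; vertices are indexed from 0.\<close>

definition traversal :: "nat \<Rightarrow> nat \<Rightarrow> (nat \<times> nat) list \<Rightarrow> bool" where
  "traversal m1 m2 T \<longleftrightarrow>
     T \<noteq> [] \<and> hd T = (0, 0) \<and> last T = (m1 - 1, m2 - 1) \<and>
     (\<forall>k. Suc k < length T \<longrightarrow>
        (case (T ! k, T ! Suc k) of ((i, j), (i', j')) \<Rightarrow>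
           (i' = i \<or> i' = i + 1) \<and> (j' = j \<or> j' = j + 1) \<and> (i' - i) + (j' - j) \<ge> 1))"

text \<open>\<^const>\<open>Min\<close> is taken over a nonempty finite set when both curves are nonempty:
  the sum of the two indices increases along a traversal, so its length is at most
  the total number of vertices.\<close>

definition discrete_frechet ::
    "'a::real_normed_vector list \<Rightarrow> 'a list \<Rightarrow> real" where
  "discrete_frechet P Q =
     Min ((\<lambda>T. Max ((\<lambda>(i, j). norm (P ! i - Q ! j)) ` set T))
            ` {T. traversal (length P) (length Q) T})"

definition grid :: "real \<Rightarrow> (real ^ 'n) set" where
  "grid \<delta> = {x. \<forall>i. \<exists>k::int. x $ i = \<delta> * of_int k}"

definition shifted_grid :: "real \<Rightarrow> real ^ 'n \<Rightarrow> (real ^ 'n) set" where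
  "shifted_grid \<delta> t = (\<lambda>p. p + t) ` grid \<delta>"

definition closest_points :: "'a::metric_space set \<Rightarrow> 'a \<Rightarrow> 'a set" where
  "closest_points A x = {y \<in> A. \<forall>z\<in>A. dist x y \<le> dist x z}"

text \<open>Ties are broken towards the lexicographically smallest closest point, the coordinates
  being compared in the order of the index type. For \<open>\<delta> > 0\<close> the set of closest points
  is finite and nonempty, so this point exists and is unique.\<close>

definition snap ::
    "real \<Rightarrow> real ^ ('n :: {finite, linorder}) \<Rightarrow> real ^ ('n :: {finite, linorder}) \<Rightarrow> real ^ ('n :: {finite, linorder})" where
  "snap \<delta> t x =
     (THE y. y \<in> closest_points (shifted_grid \<delta> t) x \<and>
        (\<forall>z \<in> closest_points (shifted_grid \<delta> t) x. z \<noteq> y \<longrightarrow> less_fun (($) y) (($) z)))"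

definition curve_hash ::
    "real \<Rightarrow> real ^ ('n :: {finite, linorder}) \<Rightarrow> (real ^ ('n :: {finite, linorder})) list \<Rightarrow> (real ^ ('n :: {finite, linorder})) list" where
  "curve_hash \<delta> t P = remdups_adj (map (snap \<delta> t) P)"

definition shift_cube :: "real \<Rightarrow> (real ^ 'n) set" where
  "shift_cube \<delta> = {t. \<forall>i. 0 \<le> t $ i \<and> t $ i < \<delta>}"

definition random_shift :: "real \<Rightarrow> (real ^ 'n) measure" where
  "random_shift \<delta> = uniform_measure lborel (shift_cube \<delta>)"

end

theory Submission
  imports Defs
begin

text \<open>Two sequences agree after removing consecutive duplicates iff some traversal matches only
  equal entries. Hence the hashes agree iff some traversal pairs only vertices with the same snap.
  Such a pair is at distance at most \<open>\<delta> * sqrt d\<close>, which gives (ii). For (i), take an optimal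
  traversal, of cost at most \<open>\<rho> < r\<close>. If for each vertex \<open>p\<close> of the shorter curve no cell boundary
  meets the cube of radius \<open>\<rho>\<close> around \<open>p\<close>, then all its pairs snap together. For one vertex and one
  coordinate a boundary is met with probability at most \<open>2 * \<rho> / \<delta>\<close>, so by the union bound the
  hashes differ with probability at most \<open>m * d * 2 * \<rho> / \<delta> = \<rho> / (2 * r) < 1 / 2\<close>.\<close>

section \<open>Traversals\<close>

lemma traversal_step:
  assumes "traversal m1 m2 T" "Suc k < length T"
  shows "fst (T ! Suc k) \<in> {fst (T ! k), Suc (fst (T ! k))}"
    and "snd (T ! Suc k) \<in> {snd (T ! k), Suc (snd (T ! k))}"
    and "T ! Suc k \<noteq> T ! k"
  using assms by (auto simp: traversal_def split_beta prod_eq_iff)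

lemma traversal_mono:
  assumes "traversal m1 m2 T" "k \<le> l" "l < length T"
  shows "fst (T ! k) \<le> fst (T ! l) \<and> snd (T ! k) \<le> snd (T ! l)"
  using assms(2,3)
proof (induction l rule: dec_induct)
  case (step n)
  then show ?case
    using traversal_step(1,2)[OF assms(1), of n] by auto
qed simp

lemma traversal_bounds:
  assumes T: "traversal m1 m2 T" and "m1 > 0" "m2 > 0" and k: "k < length T"
  shows "fst (T ! k) < m1" "snd (T ! k) < m2"
proof -
  have last: "T ! (length T - 1) = (m1 - 1, m2 - 1)"
    using T by (auto simp: traversal_def last_conv_nth)
  have "k \<le> length T - 1" "length T - 1 < length T"
    using k by auto
  from traversal_mono[OF T this]
  show "fst (T ! k) < m1" "snd (T ! k) < m2"
    using assms(2,3) unfolding last by auto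
qed

lemma traversal_set_subset:
  assumes "traversal m1 m2 T" "m1 > 0" "m2 > 0"
  shows "set T \<subseteq> {..<m1} \<times> {..<m2}"
  using traversal_bounds[OF assms] by (fastforce simp: in_set_conv_nth)

text \<open>The index sum starts at 0 and grows in every step, so at position \<open>k\<close> it is
  at least \<open>k\<close>, while the indices stay below \<open>m1\<close> and \<open>m2\<close>.
  Together with the index bounds this leaves only finitely many traversals.\<close>

lemma traversal_length:
  assumes T: "traversal m1 m2 T" and "m1 > 0" "m2 > 0"
  shows "length T \<le> m1 + m2"
proof -
  have ge: "k \<le> fst (T ! k) + snd (T ! k)" if "k < length T" for k
    using that
  proof (induction k)
    case (Suc k)
    then show ?case
      using traversal_step[OF T, of k] by (auto simp: prod_eq_iff)
  qed simp
  have "length T - 1 < length T"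
    using T by (auto simp: traversal_def)
  then show ?thesis
    using ge[of "length T - 1"] traversal_bounds[OF assms, of "length T - 1"] by linarith
qed

lemma finite_traversals:
  assumes "m1 > 0" "m2 > 0"
  shows "finite {T. traversal m1 m2 T}"
proof (rule finite_subset)
  show "{T. traversal m1 m2 T} \<subseteq>
      {T. set T \<subseteq> {..<m1} \<times> {..<m2} \<and> length T \<le> m1 + m2}"
    using traversal_set_subset traversal_length assms by blast
qed (simp add: finite_lists_length_le)

lemma traversal_single: "traversal (Suc 0) (Suc 0) [(0, 0)]"
  by (simp add: traversal_def)

text \<open>The three choices of \<open>(n1, n2)\<close> are the three admissible moves. Lengthening
  a traversal at its end mirrors appending an entry to one or both sequences.\<close>

lemma traversal_snoc:
  assumes T: "traversal m1 m2 T" and pos: "m1 > 0" "m2 > 0"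
    and n: "n1 \<in> {m1, Suc m1}" "n2 \<in> {m2, Suc m2}" "(n1, n2) \<noteq> (m1, m2)"
  shows "traversal n1 n2 (T @ [(n1 - 1, n2 - 1)])"
proof -
  have ne: "T \<noteq> []" and last: "T ! (length T - 1) = (m1 - 1, m2 - 1)"
    using T by (auto simp: traversal_def last_conv_nth)
  show ?thesis
    unfolding traversal_def
  proof (intro conjI allI impI)
    fix k assume k: "Suc k < length (T @ [(n1 - 1, n2 - 1)])"
    show "case ((T @ [(n1 - 1, n2 - 1)]) ! k, (T @ [(n1 - 1, n2 - 1)]) ! Suc k) of
        ((i, j), (i', j')) \<Rightarrow>
           (i' = i \<or> i' = i + 1) \<and> (j' = j \<or> j' = j + 1) \<and> (i' - i) + (j' - j) \<ge> 1"
    proof (cases "Suc k < length T")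
      case True
      then show ?thesis
        using T by (simp add: traversal_def nth_append)
    next
      case False
      with k have "k = length T - 1" "Suc k = length T" by auto
      then show ?thesis
        using last pos n ne by (auto simp: nth_append)
    qed
  qed (use T ne in \<open>auto simp: traversal_def\<close>)
qed

section \<open>Removal of consecutive duplicates in terms of traversals\<close>

lemma remdups_adj_snoc:
  "remdups_adj (xs @ [x]) =
     (if xs \<noteq> [] \<and> last xs = x then remdups_adj xs else remdups_adj xs @ [x])"
  by (cases xs rule: rev_cases) (auto simp: remdups_adj_append_two)

text \<open>Induction on the total length, peeling off last entries, which agree because
  \<open>remdups_adj\<close> keeps the last entry. If one sequence ends in a repeated entry, only
  that copy is dropped; otherwise both last entries are dropped. Each removal undoes one traversal
  step.\<close>

lemma remdups_adj_eq_imp_traversal: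
  assumes "remdups_adj xs = remdups_adj ys" "xs \<noteq> []" "ys \<noteq> []"
  shows "\<exists>T. traversal (length xs) (length ys) T \<and> (\<forall>(i, j)\<in>set T. xs ! i = ys ! j)"
  using assms
proof (induction "length xs + length ys" arbitrary: xs ys rule: less_induct)
  case less
  obtain us x where xs: "xs = us @ [x]" using less.prems(2) by (cases xs rule: rev_cases) auto
  obtain vs y where ys: "ys = vs @ [y]" using less.prems(3) by (cases ys rule: rev_cases) auto
  have "last (remdups_adj xs) = last (remdups_adj ys)"
    using less.prems(1) by simp
  then have [simp]: "y = x" by (simp add: xs ys)
  \<comment> \<open>A matching traversal of the shortened sequences is extended by the pair of last
    positions, whose entries are both \<open>x\<close>. Excluding \<open>(xs, ys)\<close> itself
    makes the total length drop.\<close>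
  have extend: ?case
    if us': "us' \<in> {us, xs}" and vs': "vs' \<in> {vs, ys}" and "(us', vs') \<noteq> (xs, ys)"
      and "us' \<noteq> []" "vs' \<noteq> []" and eq: "remdups_adj us' = remdups_adj vs'" for us' vs'
  proof -
    have "length us' + length vs' < length xs + length ys"
      using that by (auto simp: xs ys)
    from less.hyps[OF this eq \<open>us' \<noteq> []\<close> \<open>vs' \<noteq> []\<close>] obtain T
      where T: "traversal (length us') (length vs') T"
        and match: "\<forall>(i, j)\<in>set T. us' ! i = vs' ! j" by blast
    have "traversal (length xs) (length ys) (T @ [(length xs - 1, length ys - 1)])"
      using that by (intro traversal_snoc[OF T]) (auto simp: xs ys)
    moreover have "xs ! i = ys ! j" if "(i, j) \<in> set T" for i j
    proof -
      have "i < length us'" "j < length vs'"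
        using traversal_set_subset[OF T] that \<open>us' \<noteq> []\<close> \<open>vs' \<noteq> []\<close> by auto
      then have "us' ! i = xs ! i" "vs' ! j = ys ! j"
        using us' vs' by (auto simp: xs ys nth_append)
      then show ?thesis using match that by auto
    qed
    moreover have "xs ! (length xs - 1) = ys ! (length ys - 1)"
      by (simp add: xs ys)
    ultimately show ?thesis
      by (intro exI[of _ "T @ [(length xs - 1, length ys - 1)]"]) auto
  qed
  have eq: "remdups_adj (us @ [x]) = remdups_adj (vs @ [x])"
    using less.prems(1) by (simp add: xs ys)
  consider (left) "us \<noteq> []" "last us = x" | (right) "vs \<noteq> []" "last vs = x"
    | (both) "us = [] \<or> last us \<noteq> x" "vs = [] \<or> last vs \<noteq> x" by blast
  then show ?case
  proof cases
    case left
    then show ?thesis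
      using eq by (intro extend[of us ys]) (auto simp: xs ys remdups_adj_snoc)
  next
    case right
    then show ?thesis
      using eq by (intro extend[of xs vs]) (auto simp: xs ys remdups_adj_snoc)
  next
    case both
    \<comment> \<open>Neither last entry is a repetition, so both survive as a final
      \<open>x\<close> that can be cancelled.\<close>
    then have eq': "remdups_adj us = remdups_adj vs"
      using eq by (auto simp: remdups_adj_snoc split: if_splits)
    show ?thesis
    proof (cases "us = []")
      case True
      with eq' have "vs = []" by (metis remdups_adj_Nil_iff)
      with True show ?thesis
        using traversal_single by (auto simp: xs ys)
    next
      case False
      with eq' have "vs \<noteq> []" by auto
      with False eq' show ?thesis
        by (intro extend[of us vs]) (auto simp: xs ys)
    qed
  qed
qed

text \<open>Along the traversal, the prefixes up to the current pair keep the same reduced form. If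
  only one index moves, its new entry equals the stationary entry of the other sequence and hence
  its own predecessor, so nothing is appended. If both move, matching before and after the step
  means that both sides append the same entry or neither does.\<close>

lemma traversal_imp_remdups_adj_eq:
  assumes T: "traversal (length xs) (length ys) T" and ne: "xs \<noteq> []" "ys \<noteq> []"
    and match: "\<forall>(i, j)\<in>set T. xs ! i = ys ! j"
  shows "remdups_adj xs = remdups_adj ys"
proof -
  have eq: "xs ! fst (T ! k) = ys ! snd (T ! k)" if "k < length T" for k
    using match nth_mem[OF that] by (auto simp: split_beta)
  have snoc: "remdups_adj (take (Suc (Suc i)) zs) =
      (if zs ! i = zs ! Suc i then remdups_adj (take (Suc i) zs)
       else remdups_adj (take (Suc i) zs) @ [zs ! Suc i])"
    if "Suc i < length zs" for i and zs :: "'a list"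
  proof -
    have "last (take (Suc i) zs) = zs ! i"
      using that by (simp add: take_Suc_conv_app_nth)
    then show ?thesis
      using that by (subst take_Suc_conv_app_nth[OF that], subst remdups_adj_snoc) auto
  qed
  have prefix: "remdups_adj (take (Suc (fst (T ! k))) xs) = remdups_adj (take (Suc (snd (T ! k))) ys)"
    if "k < length T" for k
    using that
  proof (induction k)
    case 0
    have "T ! 0 = (0, 0)"
      using T by (auto simp: traversal_def hd_conv_nth)
    then show ?case
      using eq[OF 0] ne by (cases xs; cases ys) auto
  next
    case (Suc k)
    then have k: "k < length T" and
      IH: "remdups_adj (take (Suc (fst (T ! k))) xs) = remdups_adj (take (Suc (snd (T ! k))) ys)"
      by auto
    have "fst (T ! Suc k) < length xs" "snd (T ! Suc k) < length ys"
      using traversal_bounds[OF T _ _ Suc.prems] ne by auto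
    then show ?case
      using traversal_step[OF T Suc.prems] IH eq[OF k] eq[OF Suc.prems]
      by (elim insertE emptyE) (auto simp: snoc prod_eq_iff)
  qed
  have "T ! (length T - 1) = (length xs - 1, length ys - 1)" "length T - 1 < length T"
    using T by (auto simp: traversal_def last_conv_nth)
  with prefix[of "length T - 1"] ne show ?thesis by simp
qed

lemma remdups_adj_eq_iff_traversal:
  assumes "xs \<noteq> []" "ys \<noteq> []"
  shows "remdups_adj xs = remdups_adj ys \<longleftrightarrow>
    (\<exists>T. traversal (length xs) (length ys) T \<and> (\<forall>(i, j)\<in>set T. xs ! i = ys ! j))"
  using remdups_adj_eq_imp_traversal[OF _ assms] traversal_imp_remdups_adj_eq[OF _ assms]
  by blast

text \<open>Constant sequences reduce to a single entry, so equality of their reduced forms yields a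
  traversal for any two positive lengths.\<close>

lemma traversal_exists:
  assumes "m1 > 0" "m2 > 0"
  shows "\<exists>T. traversal m1 m2 T"
  using remdups_adj_eq_imp_traversal[of "replicate m1 ()" "replicate m2 ()"] assms
  by (auto simp: remdups_adj_replicate)

section \<open>The discrete Frechet distance as an attained minimum\<close>

lemma discrete_frechet_obtain:
  assumes "P \<noteq> []" "Q \<noteq> []"
  obtains T where "traversal (length P) (length Q) T"
    and "\<And>i j. (i, j) \<in> set T \<Longrightarrow> norm (P ! i - Q ! j) \<le> discrete_frechet P Q"
proof -
  let ?cost = "\<lambda>T. Max ((\<lambda>(i, j). norm (P ! i - Q ! j)) ` set T)"
  let ?S = "{T. traversal (length P) (length Q) T}"
  have "finite ?S" "?S \<noteq> {}"
    using assms finite_traversals traversal_exists by auto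
  then have "discrete_frechet P Q \<in> ?cost ` ?S"
    unfolding discrete_frechet_def by (intro Min_in) auto
  then obtain T where T: "traversal (length P) (length Q) T" "discrete_frechet P Q = ?cost T"
    by auto
  show ?thesis
    using T(1) by (rule that) (auto simp: T(2) intro!: Max_ge)
qed

lemma discrete_frechet_le:
  assumes "P \<noteq> []" "Q \<noteq> []" and T: "traversal (length P) (length Q) T"
    and le: "\<And>i j. (i, j) \<in> set T \<Longrightarrow> norm (P ! i - Q ! j) \<le> B"
  shows "discrete_frechet P Q \<le> B"
proof -
  let ?cost = "\<lambda>T. Max ((\<lambda>(i, j). norm (P ! i - Q ! j)) ` set T)"
  have "discrete_frechet P Q \<le> ?cost T"
    unfolding discrete_frechet_def using assms finite_traversals by (intro Min_le) auto
  also have "T \<noteq> []" using T by (simp add: traversal_def)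
  then have "?cost T \<le> B" using le by (subst Max_le_iff) auto
  finally show ?thesis .
qed

section \<open>Snapping to the shifted grid\<close>

text \<open>Rounding half down realises the tie rule: the lexicographically smallest closest point is the
  one that is smallest in every coordinate.\<close>

definition cell :: "real \<Rightarrow> real \<Rightarrow> real \<Rightarrow> int" where
  "cell \<delta> s x = \<lceil>(x - s) / \<delta> - 1 / 2\<rceil>"

lemma cell_mono: "\<delta> > 0 \<Longrightarrow> x \<le> y \<Longrightarrow> cell \<delta> s x \<le> cell \<delta> s y"
  unfolding cell_def by (intro ceiling_mono diff_right_mono divide_right_mono) auto

text \<open>The rounded value \<open>n\<close> satisfies
  \<open>u - 1 / 2 \<le> n < u + 1 / 2\<close>, so it is within \<open>1 / 2\<close> of
  \<open>u\<close>. The strict bound makes every smaller integer strictly farther away, so a tie can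
  only occur with a larger one.\<close>

lemma ceiling_half_nearest:
  fixes u :: real
  shows "\<bar>u - of_int \<lceil>u - 1 / 2\<rceil>\<bar> \<le> \<bar>u - of_int k\<bar>"
    and "\<bar>u - of_int k\<bar> \<le> \<bar>u - of_int \<lceil>u - 1 / 2\<rceil>\<bar> \<Longrightarrow> \<lceil>u - 1 / 2\<rceil> \<le> k"
proof -
  define n where "n = \<lceil>u - 1 / 2\<rceil>"
  have n: "u - 1 / 2 \<le> of_int n" "of_int n < u + 1 / 2"
    unfolding n_def by linarith+
  have cases: "k = n \<or> of_int k \<le> (of_int n - 1 :: real) \<or> of_int k \<ge> (of_int n + 1 :: real)"
    by linarith
  then show "\<bar>u - of_int \<lceil>u - 1 / 2\<rceil>\<bar> \<le> \<bar>u - of_int k\<bar>"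
    unfolding n_def[symmetric] using n by (elim disjE) auto
  assume "\<bar>u - of_int k\<bar> \<le> \<bar>u - of_int \<lceil>u - 1 / 2\<rceil>\<bar>"
  with cases show "\<lceil>u - 1 / 2\<rceil> \<le> k"
    unfolding n_def[symmetric] using n by (elim disjE) auto
qed

lemma cell_nearest:
  assumes "\<delta> > 0"
  shows "\<bar>x - (s + \<delta> * of_int (cell \<delta> s x))\<bar> \<le> \<bar>x - (s + \<delta> * of_int k)\<bar>"
    and "\<bar>x - (s + \<delta> * of_int k)\<bar> \<le> \<bar>x - (s + \<delta> * of_int (cell \<delta> s x))\<bar> \<Longrightarrow> cell \<delta> s x \<le> k"
proof -
  \<comment> \<open>Relative to the shift and in units of \<open>\<delta>\<close>, the grid becomes
    the integers.\<close>
  have scale: "\<bar>x - (s + \<delta> * of_int l)\<bar> = \<delta> * \<bar>(x - s) / \<delta> - of_int l\<bar>" for l :: int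
  proof -
    have "x - (s + \<delta> * of_int l) = \<delta> * ((x - s) / \<delta> - of_int l)"
      using assms by (simp add: field_simps)
    then show ?thesis using assms by (simp add: abs_mult)
  qed
  show "\<bar>x - (s + \<delta> * of_int (cell \<delta> s x))\<bar> \<le> \<bar>x - (s + \<delta> * of_int k)\<bar>"
    using ceiling_half_nearest(1) assms unfolding scale cell_def by simp
  assume "\<bar>x - (s + \<delta> * of_int k)\<bar> \<le> \<bar>x - (s + \<delta> * of_int (cell \<delta> s x))\<bar>"
  then show "cell \<delta> s x \<le> k"
    using ceiling_half_nearest(2) assms unfolding scale cell_def by simp
qed

lemma cell_dist:
  assumes "\<delta> > 0"
  shows "\<bar>x - (s + \<delta> * of_int (cell \<delta> s x))\<bar> \<le> \<delta> / 2"
proof -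
  have "(x - s) / \<delta> - 1 / 2 \<le> of_int (cell \<delta> s x)" "of_int (cell \<delta> s x) < (x - s) / \<delta> + 1 / 2"
    unfolding cell_def by linarith+
  then have "\<bar>x - (s + \<delta> * of_int (cell \<delta> s x))\<bar> * 2 \<le> \<delta>"
    using assms by (simp add: field_simps abs_if)
  then show ?thesis by simp
qed

lemma shifted_grid_iff:
  "y \<in> shifted_grid \<delta> t \<longleftrightarrow> (\<forall>i. \<exists>k::int. y $ i = t $ i + \<delta> * of_int k)"
proof
  assume R: "\<forall>i. \<exists>k::int. y $ i = t $ i + \<delta> * of_int k"
  then have "y - t \<in> grid \<delta>" by (simp add: grid_def) (metis add_diff_cancel_left')
  then show "y \<in> shifted_grid \<delta> t"
    unfolding shifted_grid_def by (intro image_eqI[of _ _ "y - t"]) auto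
qed (force simp: shifted_grid_def grid_def)

text \<open>The grid is a product and the Euclidean distance increases with each coordinate
  distance, so rounding every coordinate gives a closest point. Any other closest point ties in each
  coordinate and is therefore at least as large there; coordinatewise least implies
  lexicographically least.\<close>

lemma snap_eq:
  fixes t x :: "real ^ ('n :: {finite, linorder})"
  assumes \<delta>: "\<delta> > 0"
  shows "snap \<delta> t x = (\<chi> i. t $ i + \<delta> * of_int (cell \<delta> (t $ i) (x $ i)))"
proof -
  define y where "y = (\<chi> i. t $ i + \<delta> * of_int (cell \<delta> (t $ i) (x $ i)))"
  define C where "C = closest_points (shifted_grid \<delta> t) x"
  have y_grid: "y \<in> shifted_grid \<delta> t"
    by (auto simp: y_def shifted_grid_iff)
  have near: "\<bar>x $ i - y $ i\<bar> \<le> \<bar>x $ i - z $ i\<bar>" if z: "z \<in> shifted_grid \<delta> t" for z i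
  proof -
    obtain k :: int where "z $ i = t $ i + \<delta> * of_int k"
      using z by (auto simp: shifted_grid_iff)
    then show ?thesis
      using cell_nearest(1)[OF \<delta>] by (simp add: y_def)
  qed
  have yC: "y \<in> C"
    unfolding C_def closest_points_def using y_grid near
    by (auto simp: dist_vec_def dist_real_def intro!: L2_set_mono)
  have y_least: "y $ i \<le> z $ i" if z: "z \<in> C" for z i
  proof -
    have zg: "z \<in> shifted_grid \<delta> t" and "dist x z \<le> dist x y"
      using z y_grid by (auto simp: C_def closest_points_def)
    then have le: "(\<Sum>i\<in>UNIV. \<bar>x $ i - z $ i\<bar>\<^sup>2) \<le> (\<Sum>i\<in>UNIV. \<bar>x $ i - y $ i\<bar>\<^sup>2)"
      by (simp add: dist_vec_def dist_real_def L2_set_def)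
    \<comment> \<open>By \<open>near\<close>, no coordinate of \<open>z\<close> is closer than that
      of \<open>y\<close>; a strictly farther one would make the sum of squares strictly
      larger.\<close>
    have "\<bar>x $ i - z $ i\<bar> \<le> \<bar>x $ i - y $ i\<bar>"
    proof (rule ccontr)
      assume "\<not> ?thesis"
      then have "(\<Sum>i\<in>UNIV. \<bar>x $ i - y $ i\<bar>\<^sup>2) < (\<Sum>i\<in>UNIV. \<bar>x $ i - z $ i\<bar>\<^sup>2)"
        using near[OF zg]
        by (intro sum_strict_mono_ex1 ballI bexI[of _ i] power_mono power_strict_mono) auto
      with le show False by simp
    qed
    moreover obtain k :: int where k: "z $ i = t $ i + \<delta> * of_int k"
      using zg by (auto simp: shifted_grid_iff)
    ultimately have "cell \<delta> (t $ i) (x $ i) \<le> k"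
      by (intro cell_nearest(2)[OF \<delta>]) (simp add: y_def)
    then show ?thesis using \<delta> by (simp add: k y_def)
  qed
  have lex: "less_fun (($) y) (($) z)" if "z \<in> C" "z \<noteq> y" for z
  proof -
    \<comment> \<open>At the first coordinate where the two points differ, \<open>y\<close> is
      strictly smaller.\<close>
    define D where "D = {i. z $ i \<noteq> y $ i}"
    have "D \<noteq> {}" using \<open>z \<noteq> y\<close> by (auto simp: D_def vec_eq_iff)
    then have "Min D \<in> D" by simp
    then have "y $ Min D < z $ Min D"
      using y_least[OF \<open>z \<in> C\<close>, of "Min D"] by (auto simp: D_def)
    moreover have "y $ i = z $ i" if "i < Min D" for i
    proof -
      have "i \<notin> D"
      proof
        assume "i \<in> D"
        then have "Min D \<le> i" by (intro Min_le) simp_all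
        with that show False by simp
      qed
      then show ?thesis by (simp add: D_def)
    qed
    ultimately show ?thesis unfolding less_fun_def by blast
  qed
  have "(THE y. y \<in> C \<and> (\<forall>z\<in>C. z \<noteq> y \<longrightarrow> less_fun (($) y) (($) z))) = y"
  proof (rule the_equality)
    fix y' assume y': "y' \<in> C \<and> (\<forall>z\<in>C. z \<noteq> y' \<longrightarrow> less_fun (($) y') (($) z))"
    show "y' = y"
    proof (rule ccontr)
      assume "y' \<noteq> y"
      then have "less_fun (($) y) (($) y')" "less_fun (($) y') (($) y)"
        using y' yC lex by auto
      then show False using less_fun_asym by blast
    qed
  qed (use yC lex in simp)
  then show ?thesis by (simp add: snap_def C_def y_def)
qed

lemma snap_eq_iff:
  assumes "\<delta> > 0"
  shows "snap \<delta> t x = snap \<delta> t y \<longleftrightarrow> (\<forall>i. cell \<delta> (t $ i) (x $ i) = cell \<delta> (t $ i) (y $ i))"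
  using assms by (simp add: snap_eq vec_eq_iff)

lemma norm_snap_le:
  fixes t x :: "real ^ ('n :: {finite, linorder})"
  assumes "\<delta> > 0"
  shows "norm (x - snap \<delta> t x) \<le> sqrt (real CARD('n)) * (\<delta> / 2)"
proof -
  have "norm (x - snap \<delta> t x) \<le> L2_set (\<lambda>_::'n. \<delta> / 2) UNIV"
    unfolding norm_vec_def using cell_dist[OF assms]
    by (intro L2_set_mono) (auto simp: snap_eq[OF assms])
  then show ?thesis using assms by (simp add: L2_set_constant)
qed

section \<open>Equality of hashes as a condition on traversals\<close>

lemma curve_hash_eq_iff:
  assumes "P \<noteq> []" "Q \<noteq> []"
  shows "curve_hash \<delta> t P = curve_hash \<delta> t Q \<longleftrightarrow>
    (\<exists>T. traversal (length P) (length Q) T \<and>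
      (\<forall>(i, j)\<in>set T. snap \<delta> t (P ! i) = snap \<delta> t (Q ! j)))"
proof -
  have "(\<forall>(i, j)\<in>set T. map (snap \<delta> t) P ! i = map (snap \<delta> t) Q ! j) \<longleftrightarrow>
      (\<forall>(i, j)\<in>set T. snap \<delta> t (P ! i) = snap \<delta> t (Q ! j))"
    if "traversal (length P) (length Q) T" for T
    using traversal_set_subset[OF that] assms by (fastforce simp: split_beta)
  then have "(\<exists>T. traversal (length P) (length Q) T \<and>
        (\<forall>(i, j)\<in>set T. map (snap \<delta> t) P ! i = map (snap \<delta> t) Q ! j)) \<longleftrightarrow>
      (\<exists>T. traversal (length P) (length Q) T \<and>
        (\<forall>(i, j)\<in>set T. snap \<delta> t (P ! i) = snap \<delta> t (Q ! j)))"
    by (rule ex_cong1[OF conj_cong[OF refl]])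
  then show ?thesis
    unfolding curve_hash_def using assms by (subst remdups_adj_eq_iff_traversal) simp_all
qed

text \<open>Matched vertices share a snapped point, and each is within
  \<open>sqrt d * \<delta> / 2\<close> of it. The bound holds for every single shift, which makes
  the event in (ii) empty.\<close>

lemma discrete_frechet_le_if_curve_hash_eq:
  fixes P Q :: "(real ^ ('n :: {finite, linorder})) list"
  assumes "P \<noteq> []" "Q \<noteq> []" and \<delta>: "\<delta> > 0" and eq: "curve_hash \<delta> t P = curve_hash \<delta> t Q"
  shows "discrete_frechet P Q \<le> sqrt (real CARD('n)) * \<delta>"
proof -
  obtain T where T: "traversal (length P) (length Q) T"
    and match: "\<And>i j. (i, j) \<in> set T \<Longrightarrow> snap \<delta> t (P ! i) = snap \<delta> t (Q ! j)"
    using eq by (auto simp: curve_hash_eq_iff[OF assms(1,2)])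
  show ?thesis
  proof (rule discrete_frechet_le[OF assms(1,2) T])
    fix i j assume "(i, j) \<in> set T"
    then have eq: "snap \<delta> t (P ! i) = snap \<delta> t (Q ! j)" by (rule match)
    have "norm (P ! i - Q ! j) \<le> norm (P ! i - snap \<delta> t (P ! i)) + norm (Q ! j - snap \<delta> t (P ! i))"
      using norm_triangle_ineq4[of "P ! i - snap \<delta> t (P ! i)" "Q ! j - snap \<delta> t (P ! i)"] by simp
    also have "\<dots> \<le> sqrt (real CARD('n)) * (\<delta> / 2) + sqrt (real CARD('n)) * (\<delta> / 2)"
      using norm_snap_le[OF \<delta>, of "P ! i" t] norm_snap_le[OF \<delta>, of "Q ! j" t] eq
      by (intro add_mono) auto
    finally show "norm (P ! i - Q ! j) \<le> sqrt (real CARD('n)) * \<delta>" by (simp add: algebra_simps)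
  qed
qed

section \<open>The random shift\<close>

lemma measurable_vec_nth [measurable]: "(\<lambda>t::real ^ 'n. t $ i) \<in> borel_measurable borel"
  by (intro borel_measurable_continuous_onI continuous_intros)

lemma pred_cell_eq [measurable]:
  "Measurable.pred borel (\<lambda>t::real ^ 'n. cell \<delta> (t $ i) x = cell \<delta> (t $ i) y)"
  unfolding cell_def by measurable

text \<open>Lists of index pairs form a countable type, so the event is a countable union of finite
  intersections of cell conditions in single coordinates.\<close>

lemma pred_curve_hash_eq:
  fixes P Q :: "(real ^ ('n :: {finite, linorder})) list"
  assumes "P \<noteq> []" "Q \<noteq> []" "\<delta> > 0"
  shows "Measurable.pred borel (\<lambda>t. curve_hash \<delta> t P = curve_hash \<delta> t Q)"
  unfolding curve_hash_eq_iff[OF assms(1,2)] snap_eq_iff[OF assms(3)] split_beta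
  by measurable

text \<open>Restricting a single coordinate of the shift to an interval leaves such a slab; the
  other sides keep length \<open>\<delta>\<close>.\<close>

lemma measure_slab:
  fixes i :: "'n::finite"
  assumes "a \<le> b" "\<delta> > 0"
  shows "measure lborel (cbox (\<chi> j. if j = i then a else 0) (\<chi> j. if j = i then b else \<delta>)) =
    (b - a) * \<delta> ^ (CARD('n) - 1)" (is "measure lborel (cbox ?l ?u) = _")
proof -
  have "?l \<in> cbox ?l ?u"
    using assms by (simp add: mem_box_cart)
  then have "cbox ?l ?u \<noteq> {}" by blast
  then have "measure lborel (cbox ?l ?u) = (\<Prod>j\<in>UNIV. if j = i then b - a else \<delta>)"
    by (simp add: content_cbox_cart if_distrib cong: if_cong)
  also have "\<dots> = (b - a) * \<delta> ^ (CARD('n) - 1)"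
    by (simp add: prod.delta_remove)
  finally show ?thesis .
qed

lemma sets_shift_cube [measurable]: "(shift_cube \<delta> :: (real ^ 'n) set) \<in> sets borel"
  unfolding shift_cube_def by measurable

text \<open>The half-open cube lies between the open and the closed box, which have the same
  volume.\<close>

lemma
  assumes "\<delta> > 0"
  shows emeasure_shift_cube: "emeasure lborel (shift_cube \<delta> :: (real ^ 'n) set) = ennreal (\<delta> ^ CARD('n))"
    and measure_shift_cube: "measure lborel (shift_cube \<delta> :: (real ^ 'n) set) = \<delta> ^ CARD('n)"
proof -
  let ?u = "(\<chi> i. \<delta>) :: real ^ 'n"
  have "0 \<in> cbox 0 ?u" using assms by (simp add: mem_box_cart)
  then have "cbox 0 ?u \<noteq> {}" by blast
  then have content: "measure lborel (cbox 0 ?u) = \<delta> ^ CARD('n)"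
    by (simp add: content_cbox_cart)
  have "box 0 ?u \<subseteq> shift_cube \<delta>" "shift_cube \<delta> \<subseteq> cbox 0 ?u"
    by (auto simp: mem_box_cart shift_cube_def less_imp_le)
  then have "emeasure lborel (box 0 ?u) \<le> emeasure lborel (shift_cube \<delta> :: (real ^ 'n) set)"
      "emeasure lborel (shift_cube \<delta> :: (real ^ 'n) set) \<le> emeasure lborel (cbox 0 ?u)"
    by (intro emeasure_mono; simp)+
  moreover have "emeasure lborel (box 0 ?u) = emeasure lborel (cbox 0 ?u)"
    by (simp add: emeasure_lborel_box_eq emeasure_lborel_cbox_eq)
  moreover have "emeasure lborel (cbox 0 ?u) = ennreal (\<delta> ^ CARD('n))"
    using emeasure_eq_measure2[OF fmeasurable_cbox, of 0 ?u] content by simp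
  ultimately show *: "emeasure lborel (shift_cube \<delta> :: (real ^ 'n) set) = ennreal (\<delta> ^ CARD('n))"
    by order
  show "measure lborel (shift_cube \<delta> :: (real ^ 'n) set) = \<delta> ^ CARD('n)"
    using assms by (simp add: measure_def *)
qed

lemma prob_space_random_shift:
  "\<delta> > 0 \<Longrightarrow> prob_space (random_shift \<delta> :: (real ^ 'n) measure)"
  unfolding random_shift_def
  by (intro prob_space_uniform_measure) (auto simp: emeasure_shift_cube)

lemma sets_random_shift [measurable_cong]: "sets (random_shift \<delta>) = sets borel"
  by (simp add: random_shift_def)

lemma space_random_shift: "space (random_shift \<delta>) = UNIV"
  by (simp add: random_shift_def)

lemma measure_random_shift:
  fixes A :: "(real ^ 'n) set"
  assumes "\<delta> > 0" "A \<in> sets borel"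
  shows "measure (random_shift \<delta>) A = measure lborel (shift_cube \<delta> \<inter> A) / \<delta> ^ CARD('n)"
  unfolding random_shift_def using assms
  by (subst measure_uniform_measure) (auto simp: emeasure_shift_cube measure_shift_cube)

text \<open>The shifts separating two points at distance \<open>2 * \<rho>\<close> form an arc of length \<open>2 * \<rho>\<close> of the
  circle of shifts modulo \<open>\<delta>\<close>, cut at the origin into two intervals.\<close>

lemma cell_separated_shifts:
  assumes \<delta>: "\<delta> > 0" and \<rho>: "0 \<le> \<rho>" "2 * \<rho> \<le> \<delta>"
  obtains f where "0 \<le> f" "f < \<delta>"
    and "\<And>s. 0 \<le> s \<Longrightarrow> s < \<delta> \<Longrightarrow> cell \<delta> s (x - \<rho>) \<noteq> cell \<delta> s (x + \<rho>) \<Longrightarrow>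
      f \<le> s \<and> s \<le> f + 2 * \<rho> \<or> s \<le> f + 2 * \<rho> - \<delta>"
proof
  \<comment> \<open>In units of \<open>\<delta>\<close>, the cells of \<open>x - \<rho>\<close> and
    \<open>x + \<rho>\<close> are the ceilings of \<open>u - \<sigma>\<close> and
    \<open>u + w - \<sigma>\<close>, where \<open>\<sigma>\<close> is the rescaled shift. They
    differ only if some integer \<open>n\<close> satisfies
    \<open>u - \<sigma> \<le> n < u + w - \<sigma>\<close>, so the arc starts at
    \<open>\<delta> * frac u\<close>.\<close>
  define u where "u = (x - \<rho>) / \<delta> - 1 / 2"
  define w where "w = 2 * \<rho> / \<delta>"
  have w: "0 \<le> w" "w \<le> 1" using assms by (auto simp: w_def)
  show "0 \<le> \<delta> * frac u" "\<delta> * frac u < \<delta>"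
    using \<delta> by (auto simp: frac_lt_1)
  fix s assume s: "0 \<le> s" "s < \<delta>" and sep: "cell \<delta> s (x - \<rho>) \<noteq> cell \<delta> s (x + \<rho>)"
  define \<sigma> where "\<sigma> = s / \<delta>"
  have \<sigma>: "0 \<le> \<sigma>" "\<sigma> < 1" using s \<delta> by (auto simp: \<sigma>_def)
  define n where "n = cell \<delta> s (x - \<rho>)"
  have "n < cell \<delta> s (x + \<rho>)"
    using sep cell_mono[OF \<delta>, of "x - \<rho>" "x + \<rho>" s] \<rho> by (simp add: n_def)
  then have "of_int n < (x + \<rho> - s) / \<delta> - 1 / 2"
    by (simp add: cell_def less_ceiling_iff)
  also have "\<dots> = u + w - \<sigma>"
    by (simp add: u_def w_def \<sigma>_def add_divide_distrib diff_divide_distrib)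
  finally have upper: "of_int n < u + w - \<sigma>" .
  have "(x - \<rho> - s) / \<delta> - 1 / 2 \<le> of_int n"
    unfolding n_def cell_def by (rule le_of_int_ceiling)
  then have lower: "u - \<sigma> \<le> of_int n"
    by (simp add: u_def \<sigma>_def diff_divide_distrib)
  have f: "u = of_int \<lfloor>u\<rfloor> + frac u" "0 \<le> frac u" "frac u < 1"
    by (auto simp: frac_def frac_lt_1) linarith+
  \<comment> \<open>As \<open>\<sigma>\<close> lies in one period and \<open>w \<le> 1\<close>, only
    two integers remain; they give the two pieces of the arc.\<close>
  have "of_int \<lfloor>u\<rfloor> < (of_int n + 1 :: real)" "of_int n < (of_int \<lfloor>u\<rfloor> + 2 :: real)"
    using upper lower f w \<sigma> by linarith+
  then have "n = \<lfloor>u\<rfloor> \<or> n = \<lfloor>u\<rfloor> + 1"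
    by linarith
  then have "frac u \<le> \<sigma> \<and> \<sigma> \<le> frac u + w \<or> \<sigma> \<le> frac u + w - 1"
    using upper lower f by auto
  then have "\<delta> * frac u \<le> \<delta> * \<sigma> \<and> \<delta> * \<sigma> \<le> \<delta> * (frac u + w) \<or> \<delta> * \<sigma> \<le> \<delta> * (frac u + w - 1)"
    using \<delta> by simp
  then show "\<delta> * frac u \<le> s \<and> s \<le> \<delta> * frac u + 2 * \<rho> \<or> s \<le> \<delta> * frac u + 2 * \<rho> - \<delta>"
    using \<delta> by (simp add: \<sigma>_def w_def distrib_left right_diff_distrib)
qed

text \<open>The separating shifts lie in two slabs whose widths in coordinate \<open>i\<close> add
  up to \<open>2 * \<rho>\<close>; dividing by the volume of the cube leaves
  \<open>2 * \<rho> / \<delta>\<close>.\<close>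

lemma prob_cell_separated:
  fixes i :: "'n::finite"
  assumes \<delta>: "\<delta> > 0" and \<rho>: "0 \<le> \<rho>" "2 * \<rho> \<le> \<delta>"
  shows "measure (random_shift \<delta>) {t::real ^ 'n. cell \<delta> (t $ i) (x - \<rho>) \<noteq> cell \<delta> (t $ i) (x + \<rho>)}
    \<le> 2 * \<rho> / \<delta>"
proof -
  let ?A = "{t::real ^ 'n. cell \<delta> (t $ i) (x - \<rho>) \<noteq> cell \<delta> (t $ i) (x + \<rho>)}"
  let ?slab = "\<lambda>a b. cbox (\<chi> j. if j = i then a else 0) (\<chi> j. if j = i then b else \<delta>)"
  have A: "?A \<in> sets borel" by measurable
  obtain f where f: "0 \<le> f" "f < \<delta>"
    and arc: "\<And>s. 0 \<le> s \<Longrightarrow> s < \<delta> \<Longrightarrow> cell \<delta> s (x - \<rho>) \<noteq> cell \<delta> s (x + \<rho>) \<Longrightarrow>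
      f \<le> s \<and> s \<le> f + 2 * \<rho> \<or> s \<le> f + 2 * \<rho> - \<delta>"
    using cell_separated_shifts[OF assms] by blast
  \<comment> \<open>The truncations cover both cases: if the arc does not wrap around, the second
    slab has width 0; if it does, \<open>b2\<close> is exactly the part cut off at
    \<open>\<delta>\<close>.\<close>
  define b1 b2 where "b1 = min \<delta> (f + 2 * \<rho>)" and "b2 = max 0 (f + 2 * \<rho> - \<delta>)"
  have "shift_cube \<delta> \<inter> ?A \<subseteq> ?slab f b1 \<union> ?slab 0 b2"
  proof
    fix t assume t: "t \<in> shift_cube \<delta> \<inter> ?A"
    then have cube: "0 \<le> t $ j" "t $ j < \<delta>" for j
      by (auto simp: shift_cube_def)
    have "f \<le> t $ i \<and> t $ i \<le> f + 2 * \<rho> \<or> t $ i \<le> f + 2 * \<rho> - \<delta>"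
      using t cube by (intro arc) auto
    then have "f \<le> t $ i \<and> t $ i \<le> b1 \<or> t $ i \<le> b2"
      using cube[of i] by (auto simp: b1_def b2_def)
    then show "t \<in> ?slab f b1 \<union> ?slab 0 b2"
      using cube by (auto simp: mem_box_cart less_imp_le)
  qed
  then have "measure lborel (shift_cube \<delta> \<inter> ?A) \<le> measure lborel (?slab f b1 \<union> ?slab 0 b2)"
    using A by (intro measure_mono_fmeasurable) (auto intro: sets_shift_cube)
  also have "\<dots> \<le> measure lborel (?slab f b1) + measure lborel (?slab 0 b2)"
    by (intro measure_Un_le) auto
  also have "\<dots> = (b1 - f + b2) * \<delta> ^ (CARD('n) - 1)"
    using f \<rho> \<delta> by (subst (1 2) measure_slab) (auto simp: b1_def b2_def distrib_right)
  also have "b1 - f + b2 = 2 * \<rho>"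
    by (auto simp: b1_def b2_def)
  finally have "measure (random_shift \<delta>) ?A \<le> 2 * \<rho> * \<delta> ^ (CARD('n) - 1) / \<delta> ^ CARD('n)"
    unfolding measure_random_shift[OF \<delta> A] using \<delta> by (intro divide_right_mono) auto
  also have "\<delta> ^ CARD('n) = \<delta> * \<delta> ^ (CARD('n) - 1)"
    by (simp flip: power_Suc)
  finally show ?thesis using \<delta> by simp
qed

section \<open>Union bound over vertices and coordinates\<close>

lemma prob_balls_not_separated:
  fixes C :: "(real ^ 'n) set"
  assumes \<delta>: "\<delta> > 0" and \<rho>: "0 \<le> \<rho>" "2 * \<rho> \<le> \<delta>" and C: "finite C"
  shows "measure (random_shift \<delta>)
      {t. \<forall>p\<in>C. \<forall>i. cell \<delta> (t $ i) (p $ i - \<rho>) = cell \<delta> (t $ i) (p $ i + \<rho>)}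
    \<ge> 1 - real (card C) * real CARD('n) * (2 * \<rho> / \<delta>)"
proof -
  interpret prob_space "random_shift \<delta> :: (real ^ 'n) measure"
    by (rule prob_space_random_shift[OF \<delta>])
  let ?A = "\<lambda>(p::real^'n, i). {t. cell \<delta> (t $ i) (p $ i - \<rho>) \<noteq> cell \<delta> (t $ i) (p $ i + \<rho>)}"
  have A: "?A z \<in> events" for z
    by (cases z) simp
  have "prob (\<Union>z\<in>C \<times> UNIV. ?A z) \<le> (\<Sum>z\<in>C \<times> UNIV. prob (?A z))"
    using A C by (intro finite_measure_subadditive_finite) auto
  also have "\<dots> \<le> (\<Sum>z\<in>C \<times> (UNIV :: 'n set). 2 * \<rho> / \<delta>)"
    using prob_cell_separated[OF \<delta> \<rho>] by (intro sum_mono) auto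
  also have "\<dots> = real (card C) * real CARD('n) * (2 * \<rho> / \<delta>)"
    by (simp add: card_cartesian_product)
  finally have "1 - real (card C) * real CARD('n) * (2 * \<rho> / \<delta>) \<le>
      prob (space (random_shift \<delta>) - (\<Union>z\<in>C \<times> UNIV. ?A z))"
    using A C by (subst prob_compl) auto
  also have "space (random_shift \<delta>) - (\<Union>z\<in>C \<times> UNIV. ?A z) =
      {t. \<forall>p\<in>C. \<forall>i. cell \<delta> (t $ i) (p $ i - \<rho>) = cell \<delta> (t $ i) (p $ i + \<rho>)}"
    by (auto simp: space_random_shift)
  finally show ?thesis .
qed

text \<open>In each coordinate both points lie in the interval of radius \<open>\<rho>\<close>
  around \<open>p\<close>, and by monotonicity their cells are squeezed between the equal cells of
  its endpoints.\<close>

lemma snap_eq_if_ball_not_separated: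
  assumes \<delta>: "\<delta> > 0" and le: "norm (p - q) \<le> \<rho>"
    and eq: "\<forall>i. cell \<delta> (t $ i) (p $ i - \<rho>) = cell \<delta> (t $ i) (p $ i + \<rho>)"
  shows "snap \<delta> t p = snap \<delta> t q"
  unfolding snap_eq_iff[OF \<delta>]
proof
  fix i
  have "\<bar>p $ i - q $ i\<bar> \<le> \<rho>"
    using component_le_norm_cart[of "p - q" i] le by simp
  then have "cell \<delta> (t $ i) (p $ i - \<rho>) \<le> cell \<delta> (t $ i) (q $ i)"
      "cell \<delta> (t $ i) (q $ i) \<le> cell \<delta> (t $ i) (p $ i + \<rho>)"
      "cell \<delta> (t $ i) (p $ i - \<rho>) \<le> cell \<delta> (t $ i) (p $ i)"
      "cell \<delta> (t $ i) (p $ i) \<le> cell \<delta> (t $ i) (p $ i + \<rho>)"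
    by (auto intro!: cell_mono[OF \<delta>])
  with eq show "cell \<delta> (t $ i) (p $ i) = cell \<delta> (t $ i) (q $ i)"
    by (metis order_antisym)
qed

text \<open>Every pair of an optimal traversal contains a vertex of the shorter curve, so keeping
  the cubes around these vertices unseparated already forces all pairs to snap together. This puts
  the minimum of the lengths into the union bound.\<close>

lemma prob_curve_hash_eq:
  fixes P Q :: "(real ^ ('n :: {finite, linorder})) list"
  assumes ne: "P \<noteq> []" "Q \<noteq> []" and \<delta>: "\<delta> > 0"
    and \<rho>: "0 \<le> \<rho>" "2 * \<rho> \<le> \<delta>" and close: "discrete_frechet P Q \<le> \<rho>"
  shows "\<P>(t in random_shift \<delta>. curve_hash \<delta> t P = curve_hash \<delta> t Q) \<ge>
    1 - real (min (length P) (length Q)) * real CARD('n) * (2 * \<rho> / \<delta>)"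
proof -
  interpret prob_space "random_shift \<delta> :: (real ^ ('n :: {finite, linorder})) measure"
    by (rule prob_space_random_shift[OF \<delta>])
  obtain T where T: "traversal (length P) (length Q) T"
    and le: "\<And>i j. (i, j) \<in> set T \<Longrightarrow> norm (P ! i - Q ! j) \<le> discrete_frechet P Q"
    using discrete_frechet_obtain[OF ne] by blast
  have near: "norm (P ! i - Q ! j) \<le> \<rho>" if "(i, j) \<in> set T" for i j
    using le[OF that] close by simp
  define C where "C = (if length P \<le> length Q then set P else set Q)"
  have "finite C" and card: "card C \<le> min (length P) (length Q)"
    using card_length[of P] card_length[of Q] by (auto simp: C_def)
  let ?G = "{t. \<forall>p\<in>C. \<forall>i. cell \<delta> (t $ i) (p $ i - \<rho>) = cell \<delta> (t $ i) (p $ i + \<rho>)}"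
  have "?G \<subseteq> {t. curve_hash \<delta> t P = curve_hash \<delta> t Q}"
  proof (intro subsetI CollectI, elim CollectE)
    fix t assume G: "\<forall>p\<in>C. \<forall>i. cell \<delta> (t $ i) (p $ i - \<rho>) = cell \<delta> (t $ i) (p $ i + \<rho>)"
    have "snap \<delta> t (P ! i) = snap \<delta> t (Q ! j)" if ij: "(i, j) \<in> set T" for i j
    proof -
      have "P ! i \<in> C \<or> Q ! j \<in> C"
        using traversal_set_subset[OF T] ij ne by (auto simp: C_def)
      then show ?thesis
      proof
        assume "P ! i \<in> C"
        then show ?thesis
          using G near[OF ij] by (intro snap_eq_if_ball_not_separated[OF \<delta>]) auto
      next
        assume "Q ! j \<in> C"
        then have "snap \<delta> t (Q ! j) = snap \<delta> t (P ! i)"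
          using G near[OF ij]
          by (intro snap_eq_if_ball_not_separated[OF \<delta>]) (auto simp: norm_minus_commute)
        then show ?thesis by simp
      qed
    qed
    then show "curve_hash \<delta> t P = curve_hash \<delta> t Q"
      unfolding curve_hash_eq_iff[OF ne] using T by auto
  qed
  moreover have "{t. curve_hash \<delta> t P = curve_hash \<delta> t Q} \<in> events"
    using pred_curve_hash_eq[OF ne \<delta>] by (simp add: sets_random_shift pred_def)
  ultimately have "prob ?G \<le> prob {t. curve_hash \<delta> t P = curve_hash \<delta> t Q}"
    by (rule finite_measure_mono)
  moreover have "real (card C) * real CARD('n) * (2 * \<rho> / \<delta>) \<le>
      real (min (length P) (length Q)) * real CARD('n) * (2 * \<rho> / \<delta>)"
    using card \<delta> \<rho> by (intro mult_right_mono) auto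
  ultimately show ?thesis
    using prob_balls_not_separated[OF \<delta> \<rho> \<open>finite C\<close>] by (simp add: space_random_shift)
qed

theorem theorem7:
  fixes P Q :: "(real ^ ('n :: {finite, linorder})) list"
    and m d :: nat
    and r \<delta> c :: real
  assumes "P \<noteq> []" and "Q \<noteq> []"
    and "d = CARD('n)"
    and "m = min (length P) (length Q)"
    and "r > 0"
    and "\<delta> = 4 * real d * real m * r"
    and "c = 4 * real d powr (3 / 2) * real m"
  shows "(discrete_frechet P Q < r \<longrightarrow>
            \<P>(t in random_shift \<delta>. curve_hash \<delta> t P = curve_hash \<delta> t Q) > 1 / 2) \<and>
         (discrete_frechet P Q > c * r \<longrightarrow>
            \<P>(t in random_shift \<delta>. curve_hash \<delta> t P = curve_hash \<delta> t Q) = 0)"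
proof (intro conjI impI)
  have d: "d \<ge> 1" and m: "m \<ge> 1"
    using assms by (auto simp: Suc_le_eq)
  then have dm: "1 \<le> real d * real m"
    by (metis mult_le_mono nat_mult_1 of_nat_1 of_nat_le_iff of_nat_mult)
  have \<delta>: "\<delta> > 0"
    using d m assms by simp
  {
    \<comment> \<open>Using the distance itself as radius, instead of \<open>r\<close>, is what
      makes the final inequality strict; the maximum with 0 supplies nonnegativity directly.\<close>
    define \<rho> where "\<rho> = max 0 (discrete_frechet P Q)"
    assume "discrete_frechet P Q < r"
    then have \<rho>: "0 \<le> \<rho>" "\<rho> < r" "discrete_frechet P Q \<le> \<rho>"
      using assms(5) by (auto simp: \<rho>_def)
    have "4 * r \<le> 4 * r * (real d * real m)"
      using dm assms(5) by simp
    then have "4 * r \<le> \<delta>"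
      by (simp add: assms(6) mult_ac)
    then have "2 * \<rho> \<le> \<delta>"
      using \<rho> by simp
    from prob_curve_hash_eq[OF assms(1,2) \<delta> \<rho>(1) this \<rho>(3)]
    have "\<P>(t in random_shift \<delta>. curve_hash \<delta> t P = curve_hash \<delta> t Q) \<ge>
        1 - real m * real d * (2 * \<rho> / \<delta>)"
      by (simp add: assms(3,4))
    \<comment> \<open>The factor \<open>4 * d * m\<close> in \<open>\<delta>\<close> is chosen to
      cancel the number of vertex-coordinate pairs in the union bound.\<close>
    moreover have "real m * real d * (2 * \<rho> / \<delta>) = \<rho> / (2 * r)"
      using d m assms(5) by (simp add: assms(6) field_simps)
    moreover have "\<rho> / (2 * r) < 1 / 2"
      using \<rho> assms(5) by (simp add: field_simps)
    ultimately show "\<P>(t in random_shift \<delta>. curve_hash \<delta> t P = curve_hash \<delta> t Q) > 1 / 2"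
      by linarith
  }
  {
    assume far: "discrete_frechet P Q > c * r"
    \<comment> \<open>The exponent splits into the factor \<open>d\<close> contained in
      \<open>\<delta>\<close> and the factor \<open>sqrt d\<close> from the diameter of a grid
      cell.\<close>
    have "real d powr (3 / 2) = real d powr (1 + 1 / 2)"
      by simp
    also have "\<dots> = real d * sqrt (real d)"
      using d by (simp only: powr_add) (simp add: powr_half_sqrt)
    finally have "c * r = sqrt (real CARD('n)) * \<delta>"
      by (simp add: assms(3,6,7) mult_ac)
    then have "curve_hash \<delta> t P \<noteq> curve_hash \<delta> t Q" for t
      using discrete_frechet_le_if_curve_hash_eq[OF assms(1,2) \<delta>, of t] far by force
    then show "\<P>(t in random_shift \<delta>. curve_hash \<delta> t P = curve_hash \<delta> t Q) = 0"
      by simp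
  }
qed

end
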